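(* Let $F:\mathbb{R}^n\times\mathbb{R}^m\to\mathbb{R}$ be $\mathcal C^2$ and let $\mathcal S\subset\operatorname{Saddle}(F)$ be a closed set. Assume there exist constants $\lambda_M,k_1,k_2,\alpha_1,\beta_1>0$ and $L_x,L_z,\alpha_2,\beta_2\ge0$ such that the following hold: (i) either $L_x=0$ or $\alpha_1\le\alpha_2+1$; (ii) either $L_z=0$ or $\beta_1\le\beta_2+1$; (iii) for every $(x_*,z_* )\in\mathcal S$ and every proximal normal $\eta=(\eta_x,\eta_z)\in\mathbb{R}^n\times\mathbb{R}^m$ to $\mathcal S$ at $(x_*,z_* )$ with $\|\eta\|=1$, the functions $$[0,\lambda_M)\ni\lambda\mapsto F(x_*+\lambda\eta_x,z_* ),\qquad[0,\lambda_M)\ni\lambda\mapsto F(x_*,z_*+\lambda\eta_z)$$ are convex and concave, respectively, with $$F(x_*+\lambda\eta_x,z_* )-F(x_*,z_* )\ge k_1\|\lambda\eta_x\|^{\alpha_1},\qquad F(x_*,z_*+\lambda\eta_z)-F(x_*,z_* )\le-k_2\|\lambda\eta_z\|^{\beta_1},$$ and, for all $\lambda\in[0,\lambda_M)$ and all $t\in[0,1]$, $$\|\nabla_{xz}F(x_*+t\lambda\eta_x,z_*+\lambda\eta_z)-\nabla_{xz}F(x_*+\lambda\eta_x,z_*+t\lambda\eta_z)\|\le L_x\|\lambda\eta_x\|^{\alpha_2}+L_z\|\lambda\eta_z\|^{\beta_2}.$$ Then $\mathcal S$ is locally asymptotically stable under the saddle-point dynamics $X_{\text{sp}}$ of $F$.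 Moreover, the convergence of the trajectories is to a point if every point of $\mathcal S$ is stable. The convergence is global if, for every $\lambda_M\in\mathbb{R}_{\ge0}$, there exist $k_1,k_2,\alpha_1,\beta_1>0$ such that conditions (i), (ii) and (iii) of this statement are satisfied by these constants along with $L_x=L_z=0$.
   Context: Saddle-point dynamics: for a continuously differentiable $F:\mathbb{R}^n\times\mathbb{R}^m\to\mathbb{R}$ it is $\dot x=-\nabla_xF(x,z)$, $\dot z=\nabla_zF(x,z)$, with vector field denoted $X_{\text{sp}}$. $\nabla_{xz}F=\frac{\partial^2F}{\partial x\partial z}$ is the matrix of mixed second partial derivatives; $\|\cdot\|$ is the Euclidean norm and the induced matrix norm. Saddle points: $(x_*,z_* )$ is a (local min-max) saddle point of $F$ if there are open neighborhoods $\mathcal U_{x_*}\subset\mathbb{R}^n$ of $x_*$ and $\mathcal U_{z_*}\subset\mathbb{R}^m$ of $z_*$ with $F(x_*,z)\le F(x_*,z_* )\le F(x,z_* )$ for all $z\in\mathcal U_{z_*}$, $x\in\mathcal U_{x_*}$. $\operatorname{Saddle}(F)$ is the set of all such points; it is assumed nonempty. Proximal normals: for a closed set $\mathcal E\subset\mathbb{R}^N$ and $x\in\mathbb{R}^N\setminus\mathcal E$, let $\mathrm{proj}_{\mathcal E}(x)$ be the set of points of $\mathcal E$ closest to $x$ in Euclidean distance. For $y\in\mathrm{proj}_{\mathcal E}(x)$, the vector $x-y$ is a proximal normal direction to $\mathcal E$ at $y$, and any nonnegative multiple $t(x-y)$, $t\ge0$, is a proximal normal to $\mathcal E$ at $y$.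 Stability: a set $\mathcal S$ of equilibria is locally asymptotically stable if (a) for every $\epsilon>0$ there is an open set $W\supset\mathcal S$ such that every trajectory starting in $W$ stays within distance less than $\epsilon$ of $\mathcal S$ for all $t\ge0$, and (b) there is an open set $W\supset\mathcal S$ such that the distance to $\mathcal S$ of every trajectory starting in $W$ tends to $0$ as $t\to\infty$. Convergence is global if (b) holds with $W$ the whole space. "Convergence is to a point" means that the trajectories converging to $\mathcal S$ in (b) each converge to a single point of $\mathcal S$. A point of $\mathcal S$ is stable if it is a Lyapunov stable equilibrium. *)

theory Defs
  imports "HOL-Analysis.Analysis"
begin

section \<open>Smoothness and partial derivatives\<close>

definition C2 :: "('a::real_normed_vector \<Rightarrow> real) \<Rightarrow> bool" where
  "C2 F \<longleftrightarrow> (\<exists>(F' :: 'a \<Rightarrow> 'a \<Rightarrow>\<^sub>L real) (F'' :: 'a \<Rightarrow> 'a \<Rightarrow>\<^sub>L ('a \<Rightarrow>\<^sub>L real)).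
     (\<forall>p. (F has_derivative blinfun_apply (F' p)) (at p)) \<and>
     (\<forall>p. (F' has_derivative blinfun_apply (F'' p)) (at p)) \<and>
     continuous_on UNIV F'')"

definition dir_deriv :: "('a::real_normed_vector \<Rightarrow> real) \<Rightarrow> 'a \<Rightarrow> 'a \<Rightarrow> real" where
  "dir_deriv f v p = deriv (\<lambda>s. f (p + s *\<^sub>R v)) 0"

definition grad_x :: "((real^'n) \<times> (real^'m) \<Rightarrow> real) \<Rightarrow> (real^'n) \<times> (real^'m) \<Rightarrow> real^'n" where
  "grad_x F p = (\<chi> i. dir_deriv F (axis i 1, 0) p)"

definition grad_z :: "((real^'n) \<times> (real^'m) \<Rightarrow> real) \<Rightarrow> (real^'n) \<times> (real^'m) \<Rightarrow> real^'m" where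
  "grad_z F p = (\<chi> j. dir_deriv F (0, axis j 1) p)"

definition grad_xz :: "((real^'n) \<times> (real^'m) \<Rightarrow> real) \<Rightarrow> (real^'n) \<times> (real^'m) \<Rightarrow> real^'m^'n" where
  "grad_xz F p = (\<chi> i j. dir_deriv (dir_deriv F (0, axis j 1)) (axis i 1, 0) p)"

text \<open>The matrix norm induced by the Euclidean norms; \<open>norm\<close> on the type
  \<open>real^'m^'n\<close> would be the Frobenius norm.\<close>

definition matrix_norm :: "real^'m^'n \<Rightarrow> real" where
  "matrix_norm A = onorm (\<lambda>v. A *v v)"

text \<open>The power of a nonnegative real with the convention \<open>0\<^sup>0 = 1\<close>,
  whereas \<open>0 powr 0 = 0\<close>; a bound \<open>L * \<parallel>v\<parallel>\<^sup>0\<close> thus means the constant bound \<open>L\<close>.\<close>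

definition rpow :: "real \<Rightarrow> real \<Rightarrow> real" where
  "rpow r a = (if a = 0 then 1 else r powr a)"

section \<open>Saddle points and the saddle-point vector field\<close>

definition saddle :: "((real^'n) \<times> (real^'m) \<Rightarrow> real) \<Rightarrow> ((real^'n) \<times> (real^'m)) set" where
  "saddle F = {(x, z). \<exists>U V. open U \<and> open V \<and> x \<in> U \<and> z \<in> V \<and>
     (\<forall>z'\<in>V. F (x, z') \<le> F (x, z)) \<and> (\<forall>x'\<in>U. F (x, z) \<le> F (x', z))}"

definition X_sp :: "((real^'n) \<times> (real^'m) \<Rightarrow> real) \<Rightarrow> (real^'n) \<times> (real^'m) \<Rightarrow> (real^'n) \<times> (real^'m)" where
  "X_sp F p = (- grad_x F p, grad_z F p)"

section \<open>Proximal normals\<close>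

definition proj_set :: "'a::metric_space set \<Rightarrow> 'a \<Rightarrow> 'a set" where
  "proj_set E x = {y \<in> E. \<forall>y'\<in>E. dist x y \<le> dist x y'}"

definition proximal_normal :: "'a::real_normed_vector set \<Rightarrow> 'a \<Rightarrow> 'a \<Rightarrow> bool" where
  "proximal_normal E y \<eta> \<longleftrightarrow>
     (\<exists>x t. x \<notin> E \<and> y \<in> proj_set E x \<and> t \<ge> 0 \<and> \<eta> = t *\<^sub>R (x - y))"

definition proximal_normal_condition ::
  "((real^'n) \<times> (real^'m) \<Rightarrow> real) \<Rightarrow> ((real^'n) \<times> (real^'m)) set \<Rightarrow>
   real \<Rightarrow> real \<Rightarrow> real \<Rightarrow> real \<Rightarrow> real \<Rightarrow> real \<Rightarrow> real \<Rightarrow> real \<Rightarrow> real \<Rightarrow> bool" where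
  "proximal_normal_condition F S \<Lambda> k1 k2 \<alpha>1 \<beta>1 Lx Lz \<alpha>2 \<beta>2 \<longleftrightarrow>
     (\<forall>xs zs \<eta>x \<eta>z. (xs, zs) \<in> S \<longrightarrow> proximal_normal S (xs, zs) (\<eta>x, \<eta>z) \<longrightarrow> norm (\<eta>x, \<eta>z) = 1 \<longrightarrow>
        convex_on {0..<\<Lambda>} (\<lambda>l. F (xs + l *\<^sub>R \<eta>x, zs)) \<and>
        concave_on {0..<\<Lambda>} (\<lambda>l. F (xs, zs + l *\<^sub>R \<eta>z)) \<and>
        (\<forall>l\<in>{0..<\<Lambda>}.
           F (xs + l *\<^sub>R \<eta>x, zs) - F (xs, zs) \<ge> k1 * rpow (norm (l *\<^sub>R \<eta>x)) \<alpha>1 \<and>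
           F (xs, zs + l *\<^sub>R \<eta>z) - F (xs, zs) \<le> - k2 * rpow (norm (l *\<^sub>R \<eta>z)) \<beta>1 \<and>
           (\<forall>t\<in>{0..1}.
              matrix_norm (grad_xz F (xs + (t * l) *\<^sub>R \<eta>x, zs + l *\<^sub>R \<eta>z)
                         - grad_xz F (xs + l *\<^sub>R \<eta>x, zs + (t * l) *\<^sub>R \<eta>z))
                \<le> Lx * rpow (norm (l *\<^sub>R \<eta>x)) \<alpha>2 + Lz * rpow (norm (l *\<^sub>R \<eta>z)) \<beta>2)))"

definition saddle_set_conditions ::
  "((real^'n) \<times> (real^'m) \<Rightarrow> real) \<Rightarrow> ((real^'n) \<times> (real^'m)) set \<Rightarrow>
   real \<Rightarrow> real \<Rightarrow> real \<Rightarrow> real \<Rightarrow> real \<Rightarrow> real \<Rightarrow> real \<Rightarrow> real \<Rightarrow> real \<Rightarrow> bool" where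
  "saddle_set_conditions F S \<Lambda> k1 k2 \<alpha>1 \<beta>1 Lx Lz \<alpha>2 \<beta>2 \<longleftrightarrow>
     (Lx = 0 \<or> \<alpha>1 \<le> \<alpha>2 + 1) \<and>
     (Lz = 0 \<or> \<beta>1 \<le> \<beta>2 + 1) \<and>
     proximal_normal_condition F S \<Lambda> k1 k2 \<alpha>1 \<beta>1 Lx Lz \<alpha>2 \<beta>2"

section \<open>Stability and convergence\<close>

definition solution_on :: "('a::real_normed_vector \<Rightarrow> 'a) \<Rightarrow> real set \<Rightarrow> (real \<Rightarrow> 'a) \<Rightarrow> bool" where
  "solution_on X I \<gamma> \<longleftrightarrow> (\<forall>t\<in>I. (\<gamma> has_vector_derivative X (\<gamma> t)) (at t within I))"

text \<open>The two stability notions constrain every solution for as long as it exists: those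
  on all of \<open>{0..}\<close> are covered through their restrictions to \<open>{0..<T}\<close>, and
  solutions with a finite life time are covered as well. Convergence for \<open>t \<rightarrow> \<infinity>\<close>
  concerns the solutions on \<open>{0..}\<close>.\<close>

definition lyapunov_stable :: "('a::real_normed_vector \<Rightarrow> 'a) \<Rightarrow> 'a \<Rightarrow> bool" where
  "lyapunov_stable X p \<longleftrightarrow> X p = 0 \<and>
     (\<forall>\<epsilon>>0. \<exists>\<delta>>0. \<forall>T>0. \<forall>\<gamma>. solution_on X {0..<T} \<gamma> \<longrightarrow> dist (\<gamma> 0) p < \<delta> \<longrightarrow>
        (\<forall>t\<in>{0..<T}. dist (\<gamma> t) p < \<epsilon>))"

definition set_stable :: "('a::real_normed_vector \<Rightarrow> 'a) \<Rightarrow> 'a set \<Rightarrow> bool" where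
  "set_stable X S \<longleftrightarrow>
     (\<forall>\<epsilon>>0. \<exists>W. open W \<and> S \<subseteq> W \<and>
        (\<forall>T>0. \<forall>\<gamma>. solution_on X {0..<T} \<gamma> \<longrightarrow> \<gamma> 0 \<in> W \<longrightarrow>
           (\<forall>t\<in>{0..<T}. infdist (\<gamma> t) S < \<epsilon>)))"

definition attracted_from :: "('a::real_normed_vector \<Rightarrow> 'a) \<Rightarrow> 'a set \<Rightarrow> 'a set \<Rightarrow> bool" where
  "attracted_from X S W \<longleftrightarrow>
     (\<forall>\<gamma>. solution_on X {0..} \<gamma> \<longrightarrow> \<gamma> 0 \<in> W \<longrightarrow> ((\<lambda>t. infdist (\<gamma> t) S) \<longlongrightarrow> 0) at_top)"

definition locally_asymptotically_stable :: "('a::real_normed_vector \<Rightarrow> 'a) \<Rightarrow> 'a set \<Rightarrow> bool" where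
  "locally_asymptotically_stable X S \<longleftrightarrow>
     (\<forall>p\<in>S. X p = 0) \<and> set_stable X S \<and>
     (\<exists>W. open W \<and> S \<subseteq> W \<and> attracted_from X S W)"

text \<open>The trajectories referred to are those starting in a set \<open>W\<close> witnessing the local
  attractivity of \<open>S\<close>. For unbounded \<open>S\<close> it matters that \<open>W\<close> may be chosen: a
  trajectory starting outside of it may approach \<open>S\<close> while escaping to infinity.\<close>

definition convergence_to_point :: "('a::real_normed_vector \<Rightarrow> 'a) \<Rightarrow> 'a set \<Rightarrow> bool" where
  "convergence_to_point X S \<longleftrightarrow>
     (\<exists>W. open W \<and> S \<subseteq> W \<and> attracted_from X S W \<and>
        (\<forall>\<gamma>. solution_on X {0..} \<gamma> \<longrightarrow> \<gamma> 0 \<in> W \<longrightarrow> (\<exists>p\<in>S. (\<gamma> \<longlongrightarrow> p) at_top)))"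

definition globally_convergent :: "('a::real_normed_vector \<Rightarrow> 'a) \<Rightarrow> 'a set \<Rightarrow> bool" where
  "globally_convergent X S \<longleftrightarrow> attracted_from X S UNIV"

end

(* Half of the squared distance to S is a Lyapunov function. At a point p with closest point y in S,
   its upper right derivative along the flow is at most (p - y) . X_sp(p). Writing p - y = (u, w),
   the mean value theorem and the symmetry of the second derivative split this product into the two
   slopes of F along (u, 0) and (0, w), which convexity and the growth condition make negative, and
   a remainder containing the variation of the mixed Hessian, which for small |p - y| is absorbed by
   half of the negative part. The resulting decay rate depends on the distance to S only. *)
theory Submission
  imports Defs
begin

section \<open>Growth bounds from one-sided steps, and restarting of solutions\<close>

text \<open>Continuous induction: the times at which the bound holds form a compact set, and a
  largest such time below \<open>b\<close> could be moved to the right by \<open>step\<close>.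
  Asking for \<open>step\<close> only where the bound already holds lets an application use the
  bound itself to stay inside a tube.\<close>

lemma right_growth_bound:
  fixes f :: "real \<Rightarrow> real"
  assumes "a \<le> b" and cont: "continuous_on {a..b} f"
    and step: "\<And>t. a \<le> t \<Longrightarrow> t < b \<Longrightarrow> f t \<le> f a + K * (t - a) \<Longrightarrow>
      \<exists>d>0. \<forall>h. 0 < h \<and> h < d \<longrightarrow> f (t + h) \<le> f t + K * h"
  shows "f b \<le> f a + K * (b - a)"
proof -
  define T where "T = {t \<in> {a..b}. f t \<le> f a + K * (t - a)}"
  have "closed T"
    unfolding T_def by (intro continuous_on_closed_Collect_le cont continuous_intros)
  moreover have "bounded T"
    by (rule bounded_subset[of "{a..b}"]) (auto simp: T_def)
  ultimately have "compact T"
    by (simp add: compact_eq_bounded_closed)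
  moreover have "a \<in> T"
    using \<open>a \<le> b\<close> by (simp add: T_def)
  ultimately obtain c where c: "c \<in> T" and max: "\<And>t. t \<in> T \<Longrightarrow> t \<le> c"
    using compact_attains_sup[of T] by blast
  have "c = b"
  proof (rule ccontr)
    assume "c \<noteq> b"
    then have "a \<le> c" "c < b" "f c \<le> f a + K * (c - a)"
      using c by (auto simp: T_def)
    then obtain d where d: "d > 0" "\<And>h. 0 < h \<Longrightarrow> h < d \<Longrightarrow> f (c + h) \<le> f c + K * h"
      using step by blast
    define h where "h = min (d / 2) (b - c)"
    have h: "0 < h" "h < d" "c + h \<le> b"
      using d(1) \<open>c < b\<close> by (auto simp: h_def)
    have "f (c + h) \<le> f a + K * (c + h - a)"
      using d(2)[OF h(1,2)] \<open>f c \<le> _\<close> by (simp add: algebra_simps)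
    then have "c + h \<in> T"
      using h \<open>a \<le> c\<close> by (simp add: T_def)
    then show False
      using max h(1) by fastforce
  qed
  then show ?thesis
    using c by (simp add: T_def)
qed

lemma solution_on_subset:
  "solution_on X I \<gamma> \<Longrightarrow> J \<subseteq> I \<Longrightarrow> solution_on X J \<gamma>"
  unfolding solution_on_def by (meson has_vector_derivative_within_subset subsetD)

lemma solution_on_shift:
  assumes "solution_on X {0..} \<gamma>" "0 \<le> s"
  shows "solution_on X {0..} (\<lambda>t. \<gamma> (s + t))"
  unfolding solution_on_def
proof
  fix t :: real
  assume "t \<in> {0..}"
  then have "(\<gamma> has_vector_derivative X (\<gamma> (s + t))) (at (s + t) within {0..})"
    using assms unfolding solution_on_def by auto
  then have g: "(\<gamma> has_vector_derivative X (\<gamma> (s + t))) (at (s + t) within ((\<lambda>t. s + t) ` {0..}))"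
    by (rule has_vector_derivative_within_subset) (use assms(2) in auto)
  have "((\<lambda>t. s + t) has_vector_derivative 1) (at t within {0..})"
    by (auto intro!: derivative_eq_intros)
  from vector_diff_chain_within[OF this g] show
    "((\<lambda>t. \<gamma> (s + t)) has_vector_derivative X (\<gamma> (s + t))) (at t within {0..})"
    by (simp add: o_def)
qed

lemma solution_on_continuous: "solution_on X I \<gamma> \<Longrightarrow> continuous_on I \<gamma>"
  unfolding solution_on_def continuous_on_eq_continuous_within
  using has_vector_derivative_continuous by blast

text \<open>A single visit close enough to \<open>p\<close> suffices: restarting the trajectory at
  that time turns Lyapunov stability into closeness at all later times.\<close>

lemma stable_limit_point:
  fixes X :: "'a::real_normed_vector \<Rightarrow> 'a"
  assumes stab: "lyapunov_stable X p" and sol: "solution_on X {0..} \<gamma>"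
    and lim: "(\<lambda>n. \<gamma> (\<tau> n)) \<longlonglongrightarrow> p" and \<tau>: "\<And>n::nat. 0 \<le> \<tau> n"
  shows "(\<gamma> \<longlongrightarrow> p) at_top"
proof (rule tendstoI)
  fix e :: real
  assume "e > 0"
  then obtain \<delta> where "\<delta> > 0" and \<delta>:
    "\<And>T \<gamma> t. T > 0 \<Longrightarrow> solution_on X {0..<T} \<gamma> \<Longrightarrow> dist (\<gamma> 0) p < \<delta> \<Longrightarrow> t \<in> {0..<T} \<Longrightarrow>
      dist (\<gamma> t) p < e"
    using stab unfolding lyapunov_stable_def by meson
  obtain n where n: "dist (\<gamma> (\<tau> n)) p < \<delta>"
    using tendstoD[OF lim \<open>\<delta> > 0\<close>] by (auto simp: eventually_sequentially)
  have "dist (\<gamma> t) p < e" if "t \<ge> \<tau> n" for t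
  proof -
    \<comment> \<open>Life times are half-open, so one unit is added to keep the elapsed time
      \<open>t - \<tau> n\<close> inside.\<close>
    have "solution_on X {0..<t - \<tau> n + 1} (\<lambda>t. \<gamma> (\<tau> n + t))"
      by (rule solution_on_subset[OF solution_on_shift[OF sol \<tau>]]) auto
    from \<delta>[OF _ this, of "t - \<tau> n"] show ?thesis
      using n that by simp
  qed
  then show "eventually (\<lambda>t. dist (\<gamma> t) p < e) at_top"
    unfolding eventually_at_top_linorder by blast
qed

section \<open>Stability and attraction from decay of the distance to a set\<close>

text \<open>Separates the Lyapunov argument from the saddle structure. The rate \<open>c\<close>
  depends on the distance only and is monotone, so a lower bound on the distance bounds the rate
  uniformly from below. Closest points may fail to be unique; decay is asked for with respect to one
  of them.\<close>

locale distance_decay =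
  fixes X :: "'a::euclidean_space \<Rightarrow> 'a" and S :: "'a set" and r :: real and c :: "real \<Rightarrow> real"
  assumes closed: "closed S" and nonempty: "S \<noteq> {}" and r_pos: "0 < r"
    and c_zero: "c 0 = 0" and c_pos: "\<And>l. 0 < l \<Longrightarrow> 0 < c l"
    and c_mono: "\<And>l l'. 0 \<le> l \<Longrightarrow> l \<le> l' \<Longrightarrow> c l \<le> c l'"
    and decay: "\<And>p. infdist p S < r \<Longrightarrow>
      \<exists>y\<in>S. dist p y = infdist p S \<and> (p - y) \<bullet> X p \<le> - c (infdist p S)"
begin

lemma c_nonneg: "0 \<le> l \<Longrightarrow> 0 \<le> c l"
  using c_pos[of l] c_zero by (cases "l = 0") auto

text \<open>The squared distance need not be differentiable, but it is bounded from above by the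
  smooth function \<open>\<lambda>s. (norm (\<gamma> s - y))\<^sup>2\<close>, with equality at time \<open>t\<close>, for a
  point \<open>y\<close> of \<open>S\<close> closest to \<open>\<gamma> t\<close>.\<close>

lemma infdist_square_right_growth:
  assumes sol: "solution_on X {0..<T} \<gamma>" and t: "0 \<le> t" "t < T"
    and tube: "infdist (\<gamma> t) S < r" and K: "- 2 * c (infdist (\<gamma> t) S) < K"
  shows "\<exists>d>0. \<forall>h. 0 < h \<and> h < d \<longrightarrow> (infdist (\<gamma> (t + h)) S)\<^sup>2 \<le> (infdist (\<gamma> t) S)\<^sup>2 + K * h"
proof -
  obtain y where y: "y \<in> S" "dist (\<gamma> t) y = infdist (\<gamma> t) S"
    "(\<gamma> t - y) \<bullet> X (\<gamma> t) \<le> - c (infdist (\<gamma> t) S)"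
    using decay[OF tube] by blast
  \<comment> \<open>Subtracting \<open>K * s\<close> turns the strict gap between slope and
    \<open>K\<close> into a negative right derivative, hence into a decrease of
    \<open>\<phi>\<close> on a short interval.\<close>
  define \<phi> where "\<phi> s = (\<gamma> s - y) \<bullet> (\<gamma> s - y) - K * s" for s
  have "(\<gamma> has_derivative (\<lambda>h. h *\<^sub>R X (\<gamma> t))) (at t within {0..<T})"
    using sol t by (simp add: solution_on_def has_vector_derivative_def)
  then have "(\<phi> has_real_derivative 2 * ((\<gamma> t - y) \<bullet> X (\<gamma> t)) - K) (at t within {0..<T})"
    unfolding \<phi>_def has_field_derivative_def
    by (auto intro!: derivative_eq_intros simp: algebra_simps inner_commute)
  from has_real_derivative_neg_dec_right[OF this]
  obtain d where d: "d > 0" "\<And>h. 0 < h \<Longrightarrow> t + h \<in> {0..<T} \<Longrightarrow> h < d \<Longrightarrow> \<phi> (t + h) < \<phi> t"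
    using K y(3) by auto
  have "(infdist (\<gamma> (t + h)) S)\<^sup>2 \<le> (infdist (\<gamma> t) S)\<^sup>2 + K * h"
    if "0 < h" "h < min d (T - t)" for h
  proof -
    have "(infdist (\<gamma> (t + h)) S)\<^sup>2 \<le> (dist (\<gamma> (t + h)) y)\<^sup>2"
      by (intro power_mono infdist_le y(1) infdist_nonneg)
    also have "\<dots> \<le> (dist (\<gamma> t) y)\<^sup>2 + K * h"
      using d(2)[of h] that t by (auto simp: \<phi>_def dist_norm power2_norm_eq_inner algebra_simps)
    finally show ?thesis
      using y(2) by simp
  qed
  then show ?thesis
    using d(1) t(2) by (intro exI[of _ "min d (T - t)"]) auto
qed

text \<open>Bootstrap form: tube membership and rate have to be checked only at times where the
  bound on the squared distance is already available.\<close>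

lemma infdist_square_bound:
  assumes sol: "solution_on X {0..<T} \<gamma>" and ab: "0 \<le> a" "a \<le> b" "b < T"
    and "\<And>t. a \<le> t \<Longrightarrow> t < b \<Longrightarrow> (infdist (\<gamma> t) S)\<^sup>2 \<le> (infdist (\<gamma> a) S)\<^sup>2 + K * (t - a) \<Longrightarrow>
      infdist (\<gamma> t) S < r \<and> - 2 * c (infdist (\<gamma> t) S) < K"
  shows "(infdist (\<gamma> b) S)\<^sup>2 \<le> (infdist (\<gamma> a) S)\<^sup>2 + K * (b - a)"
proof (rule right_growth_bound[where f = "\<lambda>t. (infdist (\<gamma> t) S)\<^sup>2"])
  have "continuous_on {a..b} \<gamma>"
    by (rule continuous_on_subset[OF solution_on_continuous[OF sol]]) (use ab in auto)
  then show "continuous_on {a..b} (\<lambda>t. (infdist (\<gamma> t) S)\<^sup>2)"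
    by (intro continuous_intros)
qed (use assms infdist_square_right_growth[OF sol] in auto)

text \<open>The one-sided estimate needs \<open>K\<close> strictly above \<open>- 2 * c\<close>,
  which vanishes on \<open>S\<close>. So \<open>K = 0\<close> is reached as a limit of small
  positive slopes.\<close>

lemma infdist_nonincreasing:
  assumes sol: "solution_on X {0..<T} \<gamma>" and ab: "0 \<le> a" "a \<le> b" "b < T"
    and tube: "infdist (\<gamma> a) S < r"
  shows "infdist (\<gamma> b) S \<le> infdist (\<gamma> a) S"
proof -
  have sq: "(infdist (\<gamma> a) S)\<^sup>2 < r\<^sup>2"
    using tube infdist_nonneg by (intro power_strict_mono) auto
  have "(infdist (\<gamma> b) S)\<^sup>2 \<le> (infdist (\<gamma> a) S)\<^sup>2"
  proof (rule field_le_epsilon)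
    fix e :: real
    assume "e > 0"
    \<comment> \<open>The second bound is half the room left below \<open>r\<^sup>2\<close>, so the
      growth allowed up to time \<open>b\<close> cannot leave the tube. The 1 in the denominator of
      \<open>K\<close> covers \<open>a = b\<close>.\<close>
    define e' where "e' = min e ((r\<^sup>2 - (infdist (\<gamma> a) S)\<^sup>2) / 2)"
    define K where "K = e' / (b - a + 1)"
    have "e' > 0"
      using sq \<open>e > 0\<close> by (simp add: e'_def)
    then have "K > 0"
      using ab by (simp add: K_def)
    have Ke': "K * (t - a) \<le> e'" if "t \<le> b" for t
    proof -
      have "K * (t - a) \<le> K * (b - a + 1)"
        using that \<open>K > 0\<close> by (intro mult_left_mono) auto
      then show ?thesis
        using ab by (simp add: K_def)
    qed
    have "(infdist (\<gamma> b) S)\<^sup>2 \<le> (infdist (\<gamma> a) S)\<^sup>2 + K * (b - a)"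
    proof (rule infdist_square_bound[OF sol ab])
      fix t
      assume t: "a \<le> t" "t < b" "(infdist (\<gamma> t) S)\<^sup>2 \<le> (infdist (\<gamma> a) S)\<^sup>2 + K * (t - a)"
      have "(infdist (\<gamma> t) S)\<^sup>2 < r\<^sup>2"
        using t Ke'[of t] sq by (simp add: e'_def min_def split: if_splits)
      then have "infdist (\<gamma> t) S < r"
        using r_pos by (simp add: power_less_imp_less_base)
      moreover have "- 2 * c (infdist (\<gamma> t) S) < K"
        using c_nonneg[OF infdist_nonneg, of "\<gamma> t" S] \<open>K > 0\<close> by linarith
      ultimately show "infdist (\<gamma> t) S < r \<and> - 2 * c (infdist (\<gamma> t) S) < K"
        by simp
    qed
    then show "(infdist (\<gamma> b) S)\<^sup>2 \<le> (infdist (\<gamma> a) S)\<^sup>2 + e"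
      using Ke'[of b] by (simp add: e'_def)
  qed
  then show ?thesis
    by (rule power2_le_imp_le) (rule infdist_nonneg)
qed

text \<open>By monotonicity the distance is at least \<open>m\<close> throughout, so the squared
  distance falls at rate at least \<open>2 * c m\<close>; giving up half of it supplies the required
  strict inequality.\<close>

lemma infdist_square_linear_decay:
  assumes sol: "solution_on X {0..<T} \<gamma>" and b: "0 \<le> b" "b < T"
    and tube: "infdist (\<gamma> 0) S < r" and m: "0 < m" "m \<le> infdist (\<gamma> b) S"
  shows "(infdist (\<gamma> b) S)\<^sup>2 \<le> (infdist (\<gamma> 0) S)\<^sup>2 - c m * b"
proof -
  have "(infdist (\<gamma> b) S)\<^sup>2 \<le> (infdist (\<gamma> 0) S)\<^sup>2 + (- c m) * (b - 0)"
  proof (rule infdist_square_bound[OF sol])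
    fix t :: real
    assume t: "0 \<le> t" "t < b"
    have tr: "infdist (\<gamma> t) S < r"
      using infdist_nonincreasing[OF sol _ t(1) _ tube] t b tube by simp
    have "m \<le> infdist (\<gamma> t) S"
      using infdist_nonincreasing[OF sol t(1) _ b(2) tr] t m by simp
    then have "c m \<le> c (infdist (\<gamma> t) S)" "0 < c m"
      using c_mono c_pos m by auto
    then show "infdist (\<gamma> t) S < r \<and> - 2 * c (infdist (\<gamma> t) S) < - c m"
      using tr by linarith
  qed (use b in auto)
  then show ?thesis by simp
qed

lemma set_stable: "set_stable X S"
  unfolding set_stable_def
proof (intro allI impI)
  fix \<epsilon> :: real
  assume "\<epsilon> > 0"
  have "open {p. infdist p S < min \<epsilon> r}"
    by (intro open_Collect_less continuous_intros)
  moreover have "S \<subseteq> {p. infdist p S < min \<epsilon> r}"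
    using \<open>\<epsilon> > 0\<close> r_pos by auto
  moreover have "infdist (\<gamma> t) S < \<epsilon>"
    if "solution_on X {0..<T} \<gamma>" "\<gamma> 0 \<in> {p. infdist p S < min \<epsilon> r}" "t \<in> {0..<T}" for T \<gamma> t
    using infdist_nonincreasing[OF that(1), of 0 t] that(2,3) by auto
  ultimately show "\<exists>W. open W \<and> S \<subseteq> W \<and> (\<forall>T>0. \<forall>\<gamma>. solution_on X {0..<T} \<gamma> \<longrightarrow> \<gamma> 0 \<in> W \<longrightarrow>
      (\<forall>t\<in>{0..<T}. infdist (\<gamma> t) S < \<epsilon>))"
    by blast
qed

lemma attracted: "attracted_from X S {p. infdist p S < r}"
  unfolding attracted_from_def
proof (intro allI impI tendstoI)
  fix \<gamma> and e :: real
  assume sol: "solution_on X {0..} \<gamma>" and "\<gamma> 0 \<in> {p. infdist p S < r}" and "e > 0"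
  then have tube: "infdist (\<gamma> 0) S < r" by simp
  have solT: "solution_on X {0..<T} \<gamma>" for T
    by (rule solution_on_subset[OF sol]) auto
  \<comment> \<open>If the distance were still at least \<open>e\<close> at this time, linear decay
    would push the squared distance down to -1.\<close>
  define b where "b = ((infdist (\<gamma> 0) S)\<^sup>2 + 1) / c e"
  have "c e > 0" using c_pos \<open>e > 0\<close> .
  then have "b \<ge> 0" by (simp add: b_def)
  have less: "infdist (\<gamma> b) S < e"
  proof (rule ccontr)
    assume "\<not> infdist (\<gamma> b) S < e"
    then have "(infdist (\<gamma> b) S)\<^sup>2 \<le> (infdist (\<gamma> 0) S)\<^sup>2 - c e * b"
      using infdist_square_linear_decay[OF solT[of "b + 1"] \<open>b \<ge> 0\<close> _ tube \<open>e > 0\<close>] by simp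
    also have "\<dots> < 0"
      using \<open>c e > 0\<close> by (simp add: b_def)
    finally show False by simp
  qed
  have "dist (infdist (\<gamma> t) S) 0 < e" if "t \<ge> b" for t
  proof -
    have "infdist (\<gamma> b) S < r"
      using infdist_nonincreasing[OF solT[of "b + 1"], of 0 b] tube \<open>b \<ge> 0\<close> by simp
    then have "infdist (\<gamma> t) S \<le> infdist (\<gamma> b) S"
      using infdist_nonincreasing[OF solT[of "t + 1"] \<open>b \<ge> 0\<close> that] by simp
    then show ?thesis
      using less by (simp add: infdist_nonneg)
  qed
  then show "eventually (\<lambda>t. dist (infdist (\<gamma> t) S) 0 < e) at_top"
    unfolding eventually_at_top_linorder by blast
qed

text \<open>Stability of a nearby point of \<open>S\<close> keeps the trajectory bounded, so it has
  a cluster point, which lies in the closed set \<open>S\<close> because the distance tends to 0.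
  Stability of this cluster point then upgrades clustering to convergence. \<open>W\<close> joins
  the tube, for attraction, with the balls, for boundedness.\<close>

lemma convergence_to_point:
  assumes stable: "\<And>p. p \<in> S \<Longrightarrow> lyapunov_stable X p"
  shows "convergence_to_point X S"
proof -
  have "\<forall>p\<in>S. \<exists>\<delta>>0. \<forall>T>0. \<forall>\<gamma>. solution_on X {0..<T} \<gamma> \<longrightarrow> dist (\<gamma> 0) p < \<delta> \<longrightarrow>
      (\<forall>t\<in>{0..<T}. dist (\<gamma> t) p < 1)"
    using stable unfolding lyapunov_stable_def by (meson zero_less_one)
  then obtain \<delta> where \<delta>: "\<And>p. p \<in> S \<Longrightarrow> \<delta> p > 0"
    "\<And>p T \<gamma> t. p \<in> S \<Longrightarrow> 0 < T \<Longrightarrow> solution_on X {0..<T} \<gamma> \<Longrightarrow> dist (\<gamma> 0) p < \<delta> p \<Longrightarrow>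
      t \<in> {0..<T} \<Longrightarrow> dist (\<gamma> t) p < 1"
    by metis
  define W where "W = {p. infdist p S < r} \<inter> (\<Union>p\<in>S. ball p (\<delta> p))"
  have "open W"
    unfolding W_def by (intro open_Int open_Collect_less open_UN ballI open_ball continuous_intros)
  moreover have "S \<subseteq> W"
    using \<delta>(1) r_pos by (auto simp: W_def)
  moreover have att: "attracted_from X S W"
    using attracted by (auto simp: attracted_from_def W_def)
  moreover have "\<exists>p\<in>S. (\<gamma> \<longlongrightarrow> p) at_top" if sol: "solution_on X {0..} \<gamma>" and "\<gamma> 0 \<in> W" for \<gamma>
  proof -
    obtain q where q: "q \<in> S" "dist (\<gamma> 0) q < \<delta> q"
      using \<open>\<gamma> 0 \<in> W\<close> by (auto simp: W_def dist_commute)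
    have "dist (\<gamma> t) q < 1" if "t \<ge> 0" for t
      using \<delta>(2)[OF q(1) _ solution_on_subset[OF sol] q(2), of "t + 1" t] that
      by (simp add: Icc_subset_Ici_iff subset_eq)
    then have bnd: "\<gamma> (real n) \<in> cball q 1" for n
      by (simp add: dist_commute less_imp_le)
    obtain p \<rho> where p: "strict_mono \<rho>" "((\<lambda>n. \<gamma> (real n)) \<circ> \<rho>) \<longlonglongrightarrow> p"
      using compact_cball[of q 1] bnd unfolding compact_def by meson
    have "filterlim (\<lambda>n. real (\<rho> n)) at_top sequentially"
      by (intro filterlim_compose[OF filterlim_real_sequentially] filterlim_subseq p(1))
    moreover have "((\<lambda>t. infdist (\<gamma> t) S) \<longlongrightarrow> 0) at_top"
      using att sol \<open>\<gamma> 0 \<in> W\<close> by (simp add: attracted_from_def)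
    ultimately have "(\<lambda>n. infdist (\<gamma> (real (\<rho> n))) S) \<longlonglongrightarrow> 0"
      by (rule filterlim_compose[rotated])
    moreover have "(\<lambda>n. infdist (\<gamma> (real (\<rho> n))) S) \<longlonglongrightarrow> infdist p S"
      using p(2) by (intro tendsto_intros) (simp add: o_def)
    ultimately have "infdist p S = 0"
      using LIMSEQ_unique by blast
    then have "p \<in> S"
      using in_closed_iff_infdist_zero[OF closed nonempty] by blast
    moreover have "(\<gamma> \<longlongrightarrow> p) at_top"
      by (rule stable_limit_point[OF stable[OF \<open>p \<in> S\<close>] sol, where \<tau> = "\<lambda>n. real (\<rho> n)"])
        (use p(2) in \<open>auto simp: o_def\<close>)
    ultimately show ?thesis by blast
  qed
  ultimately show ?thesis
    unfolding convergence_to_point_def by blast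
qed

end

section \<open>Second derivatives along lines and their symmetry\<close>

text \<open>In \<open>F'' p v w\<close> the first direction \<open>v\<close> is that of the outer
  differentiation: it is the derivative along \<open>v\<close> of \<open>F' p w\<close>.\<close>

locale twice_continuously_differentiable =
  fixes F :: "'a::real_normed_vector \<Rightarrow> real" and F' :: "'a \<Rightarrow> 'a \<Rightarrow>\<^sub>L real"
    and F'' :: "'a \<Rightarrow> 'a \<Rightarrow>\<^sub>L ('a \<Rightarrow>\<^sub>L real)"
  assumes F': "\<And>p. (F has_derivative blinfun_apply (F' p)) (at p)"
    and F'': "\<And>p. (F' has_derivative blinfun_apply (F'' p)) (at p)"
    and continuous_F'': "continuous_on UNIV F''"
begin

lemma has_real_derivative_line:
  "((\<lambda>s. F (q + s *\<^sub>R v)) has_real_derivative F' (q + s *\<^sub>R v) v) (at s within A)"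
proof -
  have "((\<lambda>s. q + s *\<^sub>R v) has_derivative (\<lambda>h. h *\<^sub>R v)) (at s within A)"
    by (auto intro!: derivative_eq_intros)
  from has_derivative_compose[OF this F'] show ?thesis
    by (simp add: has_field_derivative_def blinfun.scaleR_right mult_commute_abs)
qed

lemma has_real_derivative_deriv_line:
  "((\<lambda>s. F' (q + s *\<^sub>R v) w) has_real_derivative F'' (q + s *\<^sub>R v) v w) (at s within A)"
proof -
  have "((\<lambda>s. q + s *\<^sub>R v) has_derivative (\<lambda>h. h *\<^sub>R v)) (at s within A)"
    by (auto intro!: derivative_eq_intros)
  from has_derivative_compose[OF this F'']
  have "((\<lambda>s. F' (q + s *\<^sub>R v)) has_derivative (\<lambda>h. F'' (q + s *\<^sub>R v) (h *\<^sub>R v))) (at s within A)" .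
  then have "((\<lambda>s. F' (q + s *\<^sub>R v) w) has_derivative (\<lambda>h. F'' (q + s *\<^sub>R v) (h *\<^sub>R v) w)) (at s within A)"
    by (auto intro!: derivative_eq_intros)
  then show ?thesis
    by (simp add: has_field_derivative_def blinfun.scaleR_right blinfun.scaleR_left mult_commute_abs)
qed

text \<open>Two mean value theorems: along \<open>u\<close> for the increment of \<open>F\<close>
  under the shift \<open>h *\<^sub>R w\<close>, then along \<open>w\<close> for the slope in
  direction \<open>u\<close>.\<close>

lemma second_difference:
  assumes "h > 0"
  obtains s t where "0 < s" "s < h" "0 < t" "t < h"
    "F (p + h *\<^sub>R u + h *\<^sub>R w) - F (p + h *\<^sub>R u) - F (p + h *\<^sub>R w) + F p
      = h\<^sup>2 * F'' (p + s *\<^sub>R u + t *\<^sub>R w) w u"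
proof -
  define g where "g s = F ((p + h *\<^sub>R w) + s *\<^sub>R u) - F (p + s *\<^sub>R u)" for s
  have "(g has_real_derivative F' (p + h *\<^sub>R w + s *\<^sub>R u) u - F' (p + s *\<^sub>R u) u) (at s)" for s
    unfolding g_def by (intro DERIV_diff has_real_derivative_line)
  from MVT2[OF \<open>h > 0\<close> this] obtain s where s: "0 < s" "s < h"
    "g h - g 0 = (h - 0) * (F' (p + h *\<^sub>R w + s *\<^sub>R u) u - F' (p + s *\<^sub>R u) u)"
    by blast
  from MVT2[OF \<open>h > 0\<close> has_real_derivative_deriv_line[of "p + s *\<^sub>R u" w u]]
  obtain t where t: "0 < t" "t < h" "F' (p + s *\<^sub>R u + h *\<^sub>R w) u - F' (p + s *\<^sub>R u + 0 *\<^sub>R w) u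
      = (h - 0) * F'' (p + s *\<^sub>R u + t *\<^sub>R w) w u"
    by blast
  have "F (p + h *\<^sub>R u + h *\<^sub>R w) - F (p + h *\<^sub>R u) - F (p + h *\<^sub>R w) + F p = g h - g 0"
    by (simp add: g_def ac_simps)
  also have "\<dots> = h\<^sup>2 * F'' (p + s *\<^sub>R u + t *\<^sub>R w) w u"
    using s(3) t(3) by (simp add: ac_simps power2_eq_square)
  finally show ?thesis
    using that s t by blast
qed

text \<open>The second difference is symmetric in \<open>u\<close> and \<open>w\<close>.\<close>

lemma second_derivative_symmetric: "F'' p u w = F'' p w u"
proof -
  define D where "D u w h = (F (p + h *\<^sub>R u + h *\<^sub>R w) - F (p + h *\<^sub>R u) - F (p + h *\<^sub>R w) + F p) / h\<^sup>2"
    for u w h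
  \<comment> \<open>The intermediate points are squeezed to \<open>p\<close> as the step size
    1/(n+1) shrinks, and continuity of \<open>F''\<close> identifies the limit.\<close>
  have lim: "(\<lambda>n. D u w (inverse (real (Suc n)))) \<longlonglongrightarrow> F'' p w u" for u w
  proof -
    have "\<exists>s t. 0 < s \<and> s < inverse (real (Suc n)) \<and> 0 < t \<and> t < inverse (real (Suc n)) \<and>
        D u w (inverse (real (Suc n))) = F'' (p + s *\<^sub>R u + t *\<^sub>R w) w u" for n
      using second_difference[of "inverse (real (Suc n))" p u w]
      by (simp add: D_def field_simps) metis
    then obtain s t where st: "\<And>n. 0 < s n" "\<And>n. s n < inverse (real (Suc n))"
        "\<And>n. 0 < t n" "\<And>n. t n < inverse (real (Suc n))"
        "\<And>n. D u w (inverse (real (Suc n))) = F'' (p + s n *\<^sub>R u + t n *\<^sub>R w) w u"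
      by metis
    have "s \<longlonglongrightarrow> 0" "t \<longlonglongrightarrow> 0"
      using st by (auto intro!: tendsto_sandwich[OF _ _ tendsto_const LIMSEQ_inverse_real_of_nat]
          always_eventually less_imp_le)
    then have "(\<lambda>n. p + s n *\<^sub>R u + t n *\<^sub>R w) \<longlonglongrightarrow> p + 0 *\<^sub>R u + 0 *\<^sub>R w"
      by (intro tendsto_intros)
    then have "(\<lambda>n. F'' (p + s n *\<^sub>R u + t n *\<^sub>R w)) \<longlonglongrightarrow> F'' p"
      using continuous_on_tendsto_compose[OF continuous_F''] by simp
    then have "(\<lambda>n. F'' (p + s n *\<^sub>R u + t n *\<^sub>R w) w u) \<longlonglongrightarrow> F'' p w u"
      by (intro tendsto_intros)
    then show ?thesis by (simp only: st(5))
  qed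
  have "D u w h = D w u h" for h
    by (simp add: D_def ac_simps)
  then show ?thesis
    using LIMSEQ_unique[OF lim[of u w]] lim[of w u] by simp
qed

lemma dir_deriv_eq: "dir_deriv F v p = F' p v"
  using DERIV_imp_deriv[OF has_real_derivative_line[of p v 0 UNIV]] by (simp add: dir_deriv_def)

lemma dir_deriv_dir_deriv_eq: "dir_deriv (dir_deriv F w) v p = F'' p v w"
  using DERIV_imp_deriv[OF has_real_derivative_deriv_line[of p v w 0 UNIV]]
  by (simp add: dir_deriv_def[of "dir_deriv F w"] dir_deriv_eq)

end

section \<open>Auxiliary facts on linear forms, convexity and powers\<close>

text \<open>The vector of values on the basis is the Riesz representative of \<open>f\<close>. This
  converts gradients defined by coordinates into total derivatives.\<close>

lemma linear_inner_axis:
  fixes f :: "real^'n \<Rightarrow> real"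
  assumes "linear f"
  shows "u \<bullet> (\<chi> i. f (axis i 1)) = f u"
proof -
  have "u = (\<Sum>i\<in>UNIV. u $ i *\<^sub>R axis i 1)"
    using basis_expansion[of u] by (simp add: scalar_mult_eq_scaleR)
  then have "f u = f (\<Sum>i\<in>UNIV. u $ i *\<^sub>R axis i 1)"
    by (rule arg_cong)
  also have "\<dots> = (\<Sum>i\<in>UNIV. u $ i * f (axis i 1))"
    by (simp add: linear_sum[OF assms] linear_cmul[OF assms])
  finally show ?thesis
    by (simp add: inner_vec_def)
qed

text \<open>The tangent at \<open>l\<close> lies below the graph; evaluated at 0, this turns growth
  of the function into a lower bound for its slope.\<close>

lemma convex_tangent_at_zero:
  fixes g :: "real \<Rightarrow> real"
  assumes "convex_on {0..<\<Lambda>} g" "0 < l" "l < \<Lambda>" "(g has_real_derivative D) (at l)"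
  shows "g l - g 0 \<le> l * D"
proof -
  have "l \<in> interior {0..<\<Lambda>}"
    using assms(2,3) by (intro interiorI[of "{0<..<\<Lambda>}"]) auto
  from convex_on_imp_above_tangent[OF assms(1) _ this, of 0 D] show ?thesis
    using assms(2-4) has_field_derivative_at_within by (fastforce simp: algebra_simps)
qed

text \<open>One factor \<open>x\<close> raises the exponent to \<open>b + 1\<close>, which is at
  least \<open>a\<close>, so for \<open>x \<le> 1\<close> the power is at most
  \<open>x powr a\<close>; the factor \<open>y \<le> r\<close> makes the constant at most
  \<open>k / 2\<close>. The alternative \<open>L = 0\<close> leaves the radius free, as global
  convergence requires.\<close>

lemma mixed_term_le:
  assumes "0 \<le> L" "0 < k"
    and "L = 0 \<or> r \<le> 1 \<and> a \<le> b + 1 \<and> L * r \<le> k / 2"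
    and "0 \<le> x" "x \<le> r" "0 \<le> y" "y \<le> r"
  shows "L * rpow x b * x * y \<le> k / 2 * x powr a"
\<comment> \<open>At \<open>x = 0\<close> the conventions of \<open>rpow\<close> and
  \<open>powr\<close> differ, but the extra factor \<open>x\<close> makes the left side
  vanish.\<close>
proof (cases "L = 0 \<or> x = 0")
  case False
  then have x: "x > 0" and L: "r \<le> 1" "a \<le> b + 1" "L * r \<le> k / 2"
    using assms by auto
  have "L * rpow x b * x * y = (L * y) * x powr (b + 1)"
    using x by (simp add: rpow_def powr_add)
  also have "\<dots> \<le> (L * y) * x powr a"
    using L x assms by (intro mult_left_mono powr_mono') auto
  also have "\<dots> \<le> k / 2 * x powr a"
    using L assms mult_left_mono[OF \<open>y \<le> r\<close> \<open>0 \<le> L\<close>] by (intro mult_right_mono) auto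
  finally show ?thesis .
qed (use assms in auto)

section \<open>The saddle-point field and its decay along proximal normals\<close>

locale twice_continuously_differentiable_pair =
  twice_continuously_differentiable F F' F''
  for F :: "(real^'n) \<times> (real^'m) \<Rightarrow> real" and F' F''
begin

lemma inner_grad_x: "u \<bullet> grad_x F p = F' p (u, 0)"
proof -
  have "linear (\<lambda>u. F' p (u, 0))"
    by (rule linearI) (auto simp flip: blinfun.add_right blinfun.scaleR_right simp del: real_scaleR_def)
  from linear_inner_axis[OF this, of u] show ?thesis
    by (simp add: grad_x_def dir_deriv_eq)
qed

lemma inner_grad_z: "w \<bullet> grad_z F p = F' p (0, w)"
proof -
  have "linear (\<lambda>w. F' p (0, w))"
    by (rule linearI) (auto simp flip: blinfun.add_right blinfun.scaleR_right simp del: real_scaleR_def)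
  from linear_inner_axis[OF this, of w] show ?thesis
    by (simp add: grad_z_def dir_deriv_eq)
qed

lemma inner_grad_xz: "u \<bullet> (grad_xz F p *v w) = F'' p (u, 0) (0, w)"
proof -
  have "linear (\<lambda>w. F'' p v (0, w))" for v
    by (rule linearI) (auto simp flip: blinfun.add_right blinfun.scaleR_right simp del: real_scaleR_def)
  from linear_inner_axis[OF this, of w]
  have "grad_xz F p *v w = (\<chi> i. F'' p (axis i 1, 0) (0, w))"
    by (simp add: grad_xz_def dir_deriv_dir_deriv_eq matrix_vector_mult_def inner_vec_def
        mult.commute)
  moreover have "linear (\<lambda>u. F'' p (u, 0) (0, w))"
  proof (rule linearI)
    fix u v :: "real^'n" and a :: real
    show "F'' p (u + v, 0) (0, w) = F'' p (u, 0) (0, w) + F'' p (v, 0) (0, w)"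
      using blinfun.add_right[of "F'' p" "(u, 0)" "(v, 0)"] by (simp add: blinfun.add_left)
    show "F'' p (a *\<^sub>R u, 0) (0, w) = a *\<^sub>R F'' p (u, 0) (0, w)"
      using blinfun.scaleR_right[of "F'' p" a "(u, 0)"] by (simp add: blinfun.scaleR_left)
  qed
  from linear_inner_axis[OF this, of u]
  have "u \<bullet> (\<chi> i. F'' p (axis i 1, 0) (0, w)) = F'' p (u, 0) (0, w)" .
  ultimately show ?thesis by simp
qed

text \<open>Fermat's rule in each block: a local minimum in \<open>x\<close> and a local maximum in
  \<open>z\<close>.\<close>

lemma saddle_equilibrium:
  assumes "p \<in> saddle F"
  shows "X_sp F p = 0"
proof -
  obtain x z U V where p: "p = (x, z)" and UV: "open U" "open V" "x \<in> U" "z \<in> V"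
    "\<And>z'. z' \<in> V \<Longrightarrow> F (x, z') \<le> F (x, z)" "\<And>x'. x' \<in> U \<Longrightarrow> F (x, z) \<le> F (x', z)"
    using assms by (auto simp: saddle_def)
  have "((\<lambda>x. F (x, z)) has_derivative (\<lambda>u. F' (x, z) (u, 0))) (at x)"
    by (rule has_derivative_compose[OF _ F']) (auto intro!: derivative_eq_intros)
  from differential_zero_maxmin[OF UV(3,1) this] UV(6)
  have x: "(\<lambda>u. F' (x, z) (u, 0)) = (\<lambda>u. 0)" by blast
  have "((\<lambda>z. F (x, z)) has_derivative (\<lambda>w. F' (x, z) (0, w))) (at z)"
    by (rule has_derivative_compose[OF _ F']) (auto intro!: derivative_eq_intros)
  from differential_zero_maxmin[OF UV(4,2) this] UV(5)
  have z: "(\<lambda>w. F' (x, z) (0, w)) = (\<lambda>w. 0)" by blast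
  show ?thesis
    using fun_cong[OF x] fun_cong[OF z]
    by (simp add: p X_sp_def grad_x_def grad_z_def dir_deriv_eq vec_eq_iff prod_eq_iff)
qed

text \<open>The mean value theorem is applied to the difference of the two gradients contracted
  with \<open>u\<close> and \<open>w\<close>: symmetry of the second derivative turns its derivative into
  the difference of mixed Hessians of the hypothesis.\<close>

lemma inner_X_sp_le:
  assumes mixed: "\<And>t. 0 \<le> t \<Longrightarrow> t \<le> 1 \<Longrightarrow>
      matrix_norm (grad_xz F (xs + t *\<^sub>R u, zs + w) - grad_xz F (xs + u, zs + t *\<^sub>R w)) \<le> B"
  shows "(u, w) \<bullet> X_sp F (xs + u, zs + w)
    \<le> F' (xs, zs + w) (0, w) - F' (xs + u, zs) (u, 0) + B * norm u * norm w"
proof -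
  \<comment> \<open>At \<open>t = 1\<close> both base points are \<open>(xs + u, zs + w)\<close>,
    which gives the product with the field; at \<open>t = 0\<close> the slopes are those of the two
    one-block functions.\<close>
  define \<phi> where "\<phi> t = F' ((xs, zs + w) + t *\<^sub>R (u, 0)) (0, w) - F' ((xs + u, zs) + t *\<^sub>R (0, w)) (u, 0)"
    for t
  have "(\<phi> has_real_derivative F'' ((xs, zs + w) + t *\<^sub>R (u, 0)) (u, 0) (0, w)
      - F'' ((xs + u, zs) + t *\<^sub>R (0, w)) (0, w) (u, 0)) (at t)" for t
    unfolding \<phi>_def by (intro DERIV_diff has_real_derivative_deriv_line)
  from MVT2[OF zero_less_one this] obtain t where t: "0 < t" "t < 1" and
    "\<phi> 1 - \<phi> 0 = F'' ((xs, zs + w) + t *\<^sub>R (u, 0)) (u, 0) (0, w)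
      - F'' ((xs + u, zs) + t *\<^sub>R (0, w)) (0, w) (u, 0)"
    by auto
  then have "\<phi> 1 - \<phi> 0 = F'' (xs + t *\<^sub>R u, zs + w) (u, 0) (0, w)
      - F'' (xs + u, zs + t *\<^sub>R w) (u, 0) (0, w)"
    by (simp add: second_derivative_symmetric[of _ "(0, w)" "(u, 0)"])
  also have "\<dots> = u \<bullet> ((grad_xz F (xs + t *\<^sub>R u, zs + w) - grad_xz F (xs + u, zs + t *\<^sub>R w)) *v w)"
    by (simp add: matrix_vector_mult_diff_rdistrib inner_diff_right inner_grad_xz)
  also have "\<dots> \<le> norm u * (B * norm w)"
  proof -
    let ?A = "grad_xz F (xs + t *\<^sub>R u, zs + w) - grad_xz F (xs + u, zs + t *\<^sub>R w)"
    have "norm (?A *v w) \<le> matrix_norm ?A * norm w"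
      unfolding matrix_norm_def by (rule onorm) simp
    also have "\<dots> \<le> B * norm w"
      using mixed[of t] t by (intro mult_right_mono) auto
    finally show ?thesis
      by (meson norm_cauchy_schwarz mult_left_mono norm_ge_zero order_trans)
  qed
  finally have "\<phi> 1 \<le> \<phi> 0 + B * norm u * norm w"
    by (simp add: ac_simps)
  moreover have "\<phi> 1 = (u, w) \<bullet> X_sp F (xs + u, zs + w)"
    by (simp add: \<phi>_def X_sp_def inner_grad_x inner_grad_z)
  ultimately show ?thesis
    by (simp add: \<phi>_def)
qed

text \<open>The normalised displacement from a closest point is a unit proximal normal, so the
  hypothesis applies at parameter \<open>l\<close>. Convexity and concavity turn the growth
  conditions into bounds on the two slopes of \<open>inner_X_sp_le\<close>.\<close>

lemma proximal_decay:
  assumes cond: "proximal_normal_condition F S \<Lambda> k1 k2 \<alpha>1 \<beta>1 Lx Lz \<alpha>2 \<beta>2"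
    and \<alpha>1: "0 < \<alpha>1" and \<beta>1: "0 < \<beta>1"
    and y: "(xs, zs) \<in> proj_set S (xs + u, zs + w)" and nS: "(xs + u, zs + w) \<notin> S"
    and less: "norm (u, w) < \<Lambda>"
  shows "(u, w) \<bullet> X_sp F (xs + u, zs + w) \<le> - k1 * norm u powr \<alpha>1 - k2 * norm w powr \<beta>1
    + (Lx * rpow (norm u) \<alpha>2 + Lz * rpow (norm w) \<beta>2) * norm u * norm w"
proof -
  define l where "l = norm (u, w)"
  define \<eta>x where "\<eta>x = (1 / l) *\<^sub>R u"
  define \<eta>z where "\<eta>z = (1 / l) *\<^sub>R w"
  have yS: "(xs, zs) \<in> S"
    using y by (simp add: proj_set_def)
  then have "(u, w) \<noteq> 0"
    using nS by (auto simp: prod_eq_iff)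
  then have l: "0 < l" "l < \<Lambda>"
    using less by (auto simp: l_def)
  have uw: "u = l *\<^sub>R \<eta>x" "w = l *\<^sub>R \<eta>z"
    using l by (auto simp: \<eta>x_def \<eta>z_def)
  have \<eta>: "(\<eta>x, \<eta>z) = (1 / l) *\<^sub>R ((xs + u, zs + w) - (xs, zs))"
    by (simp add: \<eta>x_def \<eta>z_def)
  have "proximal_normal S (xs, zs) (\<eta>x, \<eta>z)"
    unfolding proximal_normal_def using y nS \<eta> l by (metis less_imp_le zero_less_divide_1_iff)
  moreover have "norm (\<eta>x, \<eta>z) = 1"
    using l by (simp add: \<eta> l_def del: scaleR_Pair)
  ultimately have convex: "convex_on {0..<\<Lambda>} (\<lambda>l. F (xs + l *\<^sub>R \<eta>x, zs))"
    and concave: "concave_on {0..<\<Lambda>} (\<lambda>l. F (xs, zs + l *\<^sub>R \<eta>z))"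
    and growth: "\<forall>l\<in>{0..<\<Lambda>}.
           F (xs + l *\<^sub>R \<eta>x, zs) - F (xs, zs) \<ge> k1 * rpow (norm (l *\<^sub>R \<eta>x)) \<alpha>1 \<and>
           F (xs, zs + l *\<^sub>R \<eta>z) - F (xs, zs) \<le> - k2 * rpow (norm (l *\<^sub>R \<eta>z)) \<beta>1 \<and>
           (\<forall>t\<in>{0..1}.
              matrix_norm (grad_xz F (xs + (t * l) *\<^sub>R \<eta>x, zs + l *\<^sub>R \<eta>z)
                         - grad_xz F (xs + l *\<^sub>R \<eta>x, zs + (t * l) *\<^sub>R \<eta>z))
                \<le> Lx * rpow (norm (l *\<^sub>R \<eta>x)) \<alpha>2 + Lz * rpow (norm (l *\<^sub>R \<eta>z)) \<beta>2)"
    using cond[unfolded proximal_normal_condition_def] yS by blast+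
  \<comment> \<open>Positivity of \<open>\<alpha>1\<close> and \<open>\<beta>1\<close> makes
    \<open>rpow\<close> agree with \<open>powr\<close> here, also at zero displacement.\<close>
  have "F (xs + u, zs) - F (xs, zs) \<ge> k1 * norm u powr \<alpha>1"
    and "F (xs, zs + w) - F (xs, zs) \<le> - k2 * norm w powr \<beta>1"
    and mixed: "\<And>t. 0 \<le> t \<Longrightarrow> t \<le> 1 \<Longrightarrow>
      matrix_norm (grad_xz F (xs + t *\<^sub>R u, zs + w) - grad_xz F (xs + u, zs + t *\<^sub>R w))
        \<le> Lx * rpow (norm u) \<alpha>2 + Lz * rpow (norm w) \<beta>2"
    using growth[rule_format, of l] l \<alpha>1 \<beta>1 by (simp_all add: rpow_def flip: uw scaleR_scaleR)
  moreover have "F (xs + u, zs) - F (xs, zs) \<le> F' (xs + u, zs) (u, 0)"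
  proof -
    have "((\<lambda>l. F (xs + l *\<^sub>R \<eta>x, zs)) has_real_derivative F' (xs + l *\<^sub>R \<eta>x, zs) (\<eta>x, 0)) (at l)"
      using has_real_derivative_line[of "(xs, zs)" "(\<eta>x, 0)" l UNIV] by simp
    from convex_tangent_at_zero[OF convex l this]
    show ?thesis
      using blinfun.scaleR_right[of "F' (xs + u, zs)" l "(\<eta>x, 0)"] by (simp flip: uw)
  qed
  moreover have "F' (xs, zs + w) (0, w) \<le> F (xs, zs + w) - F (xs, zs)"
  proof -
    have "((\<lambda>l. - F (xs, zs + l *\<^sub>R \<eta>z)) has_real_derivative - F' (xs, zs + l *\<^sub>R \<eta>z) (0, \<eta>z)) (at l)"
      using has_real_derivative_line[of "(xs, zs)" "(0, \<eta>z)" l UNIV] by (intro DERIV_minus) simp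
    from convex_tangent_at_zero[OF concave[unfolded concave_on_def] l this]
    show ?thesis
      using blinfun.scaleR_right[of "F' (xs, zs + w)" l "(0, \<eta>z)"] by (simp flip: uw)
  qed
  ultimately show ?thesis
    using inner_X_sp_le[OF mixed] by fastforce
qed

text \<open>Absorbing the mixed terms leaves half of each growth term. One of \<open>norm u\<close>
  and \<open>norm w\<close> is at least half the distance, whence the arguments \<open>l / 2\<close>
  and the minimum in the rate.\<close>

lemma distance_decay_X_sp:
  assumes cond: "proximal_normal_condition F S \<Lambda> k1 k2 \<alpha>1 \<beta>1 Lx Lz \<alpha>2 \<beta>2"
    and S: "closed S" "S \<noteq> {}" and r: "0 < r" "r \<le> \<Lambda>"
    and k: "0 < k1" "0 < k2" and \<alpha>1: "0 < \<alpha>1" and \<beta>1: "0 < \<beta>1"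
    and L: "0 \<le> Lx" "0 \<le> Lz"
    and Lx: "Lx = 0 \<or> r \<le> 1 \<and> \<alpha>1 \<le> \<alpha>2 + 1 \<and> Lx * r \<le> k1 / 2"
    and Lz: "Lz = 0 \<or> r \<le> 1 \<and> \<beta>1 \<le> \<beta>2 + 1 \<and> Lz * r \<le> k2 / 2"
  shows "distance_decay (X_sp F) S r (\<lambda>l. min (k1 * (l / 2) powr \<alpha>1) (k2 * (l / 2) powr \<beta>1) / 2)"
proof
  fix p :: "(real^'n) \<times> (real^'m)"
  assume tube: "infdist p S < r"
  obtain y where y: "y \<in> S" "infdist p S = dist p y"
    using infdist_attains_inf[OF S] by blast
  obtain xs zs where ys: "y = (xs, zs)" by fastforce
  obtain u w where uw: "p - y = (u, w)" by fastforce
  then have p: "p = (xs + u, zs + w)"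
    by (auto simp: ys prod_eq_iff algebra_simps)
  define l where "l = norm (u, w)"
  have l: "infdist p S = l"
    by (simp add: y(2) dist_norm uw l_def)
  have "l \<ge> 0" "l < r"
    using tube l by (auto simp: l_def)
  have ul: "norm u \<le> l" and wl: "norm w \<le> l" and lsum: "l \<le> norm u + norm w"
    by (auto simp: l_def norm_Pair intro: real_le_rsqrt sqrt_sum_squares_le_sum)
  have "(u, w) \<bullet> X_sp F p \<le> - (min (k1 * (l / 2) powr \<alpha>1) (k2 * (l / 2) powr \<beta>1) / 2)"
  \<comment> \<open>Points of \<open>S\<close> offer no proximal normal of this kind, but there the
    displacement and the rate are both 0.\<close>
  proof (cases "p \<in> S")
    case True
    then have "l = 0" using l by simp
    then show ?thesis by (simp add: l_def)
  next
    case False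
    have "y \<in> proj_set S p"
      using y(1) infdist_le[of _ S p] by (simp add: proj_set_def flip: y(2))
    then have "(u, w) \<bullet> X_sp F p \<le> - k1 * norm u powr \<alpha>1 - k2 * norm w powr \<beta>1
        + (Lx * rpow (norm u) \<alpha>2 + Lz * rpow (norm w) \<beta>2) * norm u * norm w"
      using proximal_decay[OF cond \<alpha>1 \<beta>1] False \<open>l < r\<close> r by (simp add: p ys l_def)
    moreover have "Lx * rpow (norm u) \<alpha>2 * norm u * norm w \<le> k1 / 2 * norm u powr \<alpha>1"
      using mixed_term_le[OF L(1) _ Lx, of "norm u" "norm w"] ul wl \<open>l < r\<close> k by simp
    moreover have "Lz * rpow (norm w) \<beta>2 * norm w * norm u \<le> k2 / 2 * norm w powr \<beta>1"
      using mixed_term_le[OF L(2) _ Lz, of "norm w" "norm u"] ul wl \<open>l < r\<close> k by simp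
    ultimately have "(u, w) \<bullet> X_sp F p \<le> - (k1 * norm u powr \<alpha>1 + k2 * norm w powr \<beta>1) / 2"
      by (simp add: field_simps)
    also have "\<dots> \<le> - (min (k1 * (l / 2) powr \<alpha>1) (k2 * (l / 2) powr \<beta>1) / 2)"
    proof -
      have "norm u \<ge> l / 2 \<or> norm w \<ge> l / 2"
        using lsum by linarith
      then have "k1 * (l / 2) powr \<alpha>1 \<le> k1 * norm u powr \<alpha>1 \<or>
          k2 * (l / 2) powr \<beta>1 \<le> k2 * norm w powr \<beta>1"
        using k \<alpha>1 \<beta>1 \<open>l \<ge> 0\<close> by (auto intro!: powr_mono2)
      moreover have "0 \<le> k1 * norm u powr \<alpha>1" "0 \<le> k2 * norm w powr \<beta>1"
        using k by auto
      ultimately show ?thesis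
        by (auto simp: min_def)
    qed
    finally show ?thesis .
  qed
  then show "\<exists>y\<in>S. dist p y = infdist p S \<and> (p - y) \<bullet> X_sp F p
      \<le> - (min (k1 * (infdist p S / 2) powr \<alpha>1) (k2 * (infdist p S / 2) powr \<beta>1) / 2)"
    using y l uw by metis
next
  fix l l' :: real
  assume "0 \<le> l" "l \<le> l'"
  then show "min (k1 * (l / 2) powr \<alpha>1) (k2 * (l / 2) powr \<beta>1) / 2
    \<le> min (k1 * (l' / 2) powr \<alpha>1) (k2 * (l' / 2) powr \<beta>1) / 2"
    using k \<alpha>1 \<beta>1 by (intro divide_right_mono min.mono mult_left_mono powr_mono2) auto
qed (use S r k in auto)

end

section \<open>Choice of the tube radii and conclusion\<close>

theorem proposition5p5:
  fixes F :: "(real^'n) \<times> (real^'m) \<Rightarrow> real"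
    and S :: "((real^'n) \<times> (real^'m)) set"
    and \<Lambda> k1 k2 \<alpha>1 \<beta>1 Lx Lz \<alpha>2 \<beta>2 :: real
  assumes "C2 F"
    and "saddle F \<noteq> {}"
    and "S \<subseteq> saddle F" and "closed S"
    and "\<Lambda> > 0" and "k1 > 0" and "k2 > 0" and "\<alpha>1 > 0" and "\<beta>1 > 0"
    and "Lx \<ge> 0" and "Lz \<ge> 0" and "\<alpha>2 \<ge> 0" and "\<beta>2 \<ge> 0"
    and "saddle_set_conditions F S \<Lambda> k1 k2 \<alpha>1 \<beta>1 Lx Lz \<alpha>2 \<beta>2"
  shows "locally_asymptotically_stable (X_sp F) S \<and>
    ((\<forall>p\<in>S. lyapunov_stable (X_sp F) p) \<longrightarrow> convergence_to_point (X_sp F) S) \<and>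
    ((\<forall>\<Lambda>'\<ge>0. \<exists>k1' k2' \<alpha>1' \<beta>1' \<alpha>2' \<beta>2'.
        k1' > 0 \<and> k2' > 0 \<and> \<alpha>1' > 0 \<and> \<beta>1' > 0 \<and> \<alpha>2' \<ge> 0 \<and> \<beta>2' \<ge> 0 \<and>
        saddle_set_conditions F S \<Lambda>' k1' k2' \<alpha>1' \<beta>1' 0 0 \<alpha>2' \<beta>2')
      \<longrightarrow> globally_convergent (X_sp F) S)"
proof (cases "S = {}")
  \<comment> \<open>By convention \<open>infdist\<close> to the empty set is 0, and convergence to a
    point is vacuous for empty \<open>W\<close>.\<close>
  case True
  then show ?thesis
    by (auto simp: locally_asymptotically_stable_def set_stable_def attracted_from_def
        convergence_to_point_def globally_convergent_def infdist_def)
next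
  case False
  obtain F' F'' where "twice_continuously_differentiable F F' F''"
    using \<open>C2 F\<close> unfolding C2_def twice_continuously_differentiable_def by blast
  then interpret twice_continuously_differentiable_pair F F' F''
    unfolding twice_continuously_differentiable_pair_def .
  have cond: "proximal_normal_condition F S \<Lambda> k1 k2 \<alpha>1 \<beta>1 Lx Lz \<alpha>2 \<beta>2"
    using assms by (simp add: saddle_set_conditions_def)
  \<comment> \<open>\<open>\<Lambda>\<close> keeps the hypothesis applicable, 1 allows the
    comparison of powers, and the quotients give the absorption bounds; adding 1 to
    \<open>Lx\<close> and \<open>Lz\<close> keeps the denominators positive.\<close>
  define r where "r = min (min \<Lambda> 1) (min (k1 / (2 * (Lx + 1))) (k2 / (2 * (Lz + 1))))"
  have "r > 0"
    using assms by (simp add: r_def)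
  have absorb: "L * r \<le> k / 2" if "0 \<le> L" "r \<le> k / (2 * (L + 1))" for L k
  proof -
    have "L * r \<le> (L + 1) * r"
      using \<open>r > 0\<close> by (intro mult_right_mono) auto
    also have "\<dots> \<le> k / 2"
      using that by (simp add: pos_le_divide_eq mult_ac)
    finally show ?thesis .
  qed
  have "r \<le> k1 / (2 * (Lx + 1))" "r \<le> k2 / (2 * (Lz + 1))"
    by (auto simp only: r_def min.cobounded1 min.cobounded2 intro: min.coboundedI2)
  then have "Lx * r \<le> k1 / 2" "Lz * r \<le> k2 / 2"
    using \<open>Lx \<ge> 0\<close> \<open>Lz \<ge> 0\<close> absorb by blast+
  moreover have "r \<le> \<Lambda>" "r \<le> 1"
    by (auto simp: r_def)
  ultimately interpret D: distance_decay "X_sp F" S r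
    "\<lambda>l. min (k1 * (l / 2) powr \<alpha>1) (k2 * (l / 2) powr \<beta>1) / 2"
    using assms False \<open>r > 0\<close> unfolding saddle_set_conditions_def
    by (intro distance_decay_X_sp[OF cond]) auto
  have "open {p. infdist p S < r}"
    by (intro open_Collect_less continuous_intros)
  moreover have "S \<subseteq> {p. infdist p S < r}"
    using \<open>r > 0\<close> by auto
  ultimately have "locally_asymptotically_stable (X_sp F) S"
    unfolding locally_asymptotically_stable_def
    using saddle_equilibrium \<open>S \<subseteq> saddle F\<close> D.set_stable D.attracted by blast
  moreover have "globally_convergent (X_sp F) S"
    if global: "\<forall>\<Lambda>'\<ge>0. \<exists>k1' k2' \<alpha>1' \<beta>1' \<alpha>2' \<beta>2'.
        k1' > 0 \<and> k2' > 0 \<and> \<alpha>1' > 0 \<and> \<beta>1' > 0 \<and> \<alpha>2' \<ge> 0 \<and> \<beta>2' \<ge> 0 \<and>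
        saddle_set_conditions F S \<Lambda>' k1' k2' \<alpha>1' \<beta>1' 0 0 \<alpha>2' \<beta>2'"
    unfolding globally_convergent_def attracted_from_def
  proof (intro allI impI)
    fix \<gamma>
    assume sol: "solution_on (X_sp F) {0..} \<gamma>"
    \<comment> \<open>The radius is chosen after the trajectory, so that its start lies in the tube;
      the constants and the rate may depend on it. With both Lipschitz-type constants 0 there is no
      remainder to absorb, so a large radius is admissible.\<close>
    define R where "R = infdist (\<gamma> 0) S + 1"
    have "R > 0"
      using infdist_nonneg[of "\<gamma> 0" S] by (simp add: R_def)
    then obtain k1' k2' \<alpha>1' \<beta>1' \<alpha>2' \<beta>2' where
      "k1' > 0" "k2' > 0" "\<alpha>1' > 0" "\<beta>1' > 0" "\<alpha>2' \<ge> 0" "\<beta>2' \<ge> 0"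
      and cond': "proximal_normal_condition F S R k1' k2' \<alpha>1' \<beta>1' 0 0 \<alpha>2' \<beta>2'"
      using global[rule_format, of R] by (auto simp: saddle_set_conditions_def)
    then interpret G: distance_decay "X_sp F" S R
      "\<lambda>l. min (k1' * (l / 2) powr \<alpha>1') (k2' * (l / 2) powr \<beta>1') / 2"
      using \<open>closed S\<close> False \<open>R > 0\<close> by (intro distance_decay_X_sp[OF cond']) auto
    show "((\<lambda>t. infdist (\<gamma> t) S) \<longlongrightarrow> 0) at_top"
      using G.attracted sol by (simp add: attracted_from_def R_def)
  qed
  ultimately show ?thesis
    using D.convergence_to_point by blast
qed

end
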